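(* Let $a,b$ be integers with $a,b>1$ and neither $a\mid b$ nor $b\mid a$, and consider the (admissible) heteroclinic chain in vacuum Bianchi IX with 2-periodic continued fraction development $u=[a,b,a,b,\dots]$; its base points have Kasner parameters $[m,a,b,a,b,\dots]$ for $m=1,\dots,b$ and $[m,b,a,b,a,\dots]$ for $m=1,\dots,a$. Then Takens-Linearization is possible at all base points, i.e. the Sternberg Non-Resonance Conditions (SNC) of order $\alpha(1)$ hold at every base point.
   Context: Continued fractions: $[a_0,a_1,a_2,\dots]=a_0+\cfrac{1}{a_1+\cfrac{1}{a_2+\cdots}}$ with positive integers $a_i$. Base points: a heteroclinic chain in Bianchi IX is described by its base points (equilibria on the Kasner circle), encoded by Kasner parameters $u\in(1,\infty)$. The next base point is given by the Kasner map $u\mapsto u-1$ if $u\ge 2$, $u\mapsto \frac1{u-1}$ if $1<u\le2$. Admissible: a 2-periodic $u=[a,b,a,b,\dots]$ is called admissible if $a,b>1$ and neither $a\mid b$ nor $b\mid a$. Eigenvalues: the linearized vector field at the base point with Kasner parameter $u$ has the three hyperbolic (nonzero) eigenvalues $$\lambda_1=\frac{-6u}{1+u+u^2},\quad \lambda_2=\frac{6(1+u)}{1+u+u^2},\quad \lambda_3=\frac{6u(1+u)}{1+u+u^2}.$$ Resonance Sign Condition (RSC): a triple $k=(k_1,k_2,k_3)\in\mathbb Z^3$ satisfies the RSC if either all $k_i$ have the same sign, or the one of the $k_i$ whose sign differs from that of the other two equals $\pm1$. SNC: put $$\beta(1)=\Big\lceil \tfrac{N+(M+n)}{n}\Big\rceil,\qquad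 \alpha(1)=\Big\lceil \tfrac{M+\beta(1)\,(N+m')}{m'}\Big\rceil,$$ where $M=m'=|\lambda_1|$, $n=|\lambda_2|$, $N=|\lambda_3|$ (the argument $1$ refers to $C^1$ smoothness of the linearizing coordinates). The SNC (of order $\alpha(1)$) hold at the base point with parameter $u$ if there is no $k\in\mathbb Z^3\setminus\{0\}$ with $k_1\lambda_1+k_2\lambda_2+k_3\lambda_3=0$, satisfying the RSC, with $|k|:=|k_1|+|k_2|+|k_3|\le\alpha(1)$. One says that Takens-Linearization is possible at the base point if the SNC hold there. *)

theory Defs
  imports Complex_Main
begin

fun cfrac_convergent :: "(nat \<Rightarrow> int) \<Rightarrow> nat \<Rightarrow> real" where
  "cfrac_convergent c 0 = of_int (c 0)"
| "cfrac_convergent c (Suc n) = of_int (c 0) + 1 / cfrac_convergent (\<lambda>i. c (Suc i)) n"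

text \<open>
  The value of \<open>[c 0, c 1, c 2, ...]\<close>. It is meaningful when all partial quotients are
  positive, in which case the convergents do converge.
\<close>
definition cfrac :: "(nat \<Rightarrow> int) \<Rightarrow> real" where
  "cfrac c = lim (cfrac_convergent c)"

definition alternating :: "int \<Rightarrow> int \<Rightarrow> nat \<Rightarrow> int" where
  "alternating a b n = (if even n then a else b)"

definition admissible :: "int \<Rightarrow> int \<Rightarrow> bool" where
  "admissible a b \<longleftrightarrow> a > 1 \<and> b > 1 \<and> \<not> a dvd b \<and> \<not> b dvd a"

text \<open>Only used for \<open>u > 1\<close>; at \<open>u = 2\<close> the two branches agree.\<close>
definition kasner_map :: "real \<Rightarrow> real" where
  "kasner_map u = (if u \<ge> 2 then u - 1 else 1 / (u - 1))"

text \<open>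
  The Kasner parameters of the base points of the heteroclinic chain starting at the base
  point with parameter \<open>u\<close>.
\<close>
definition base_points :: "real \<Rightarrow> real set" where
  "base_points u = {(kasner_map ^^ j) u | j. True}"

definition lambda1 :: "real \<Rightarrow> real" where
  "lambda1 u = - 6 * u / (1 + u + u\<^sup>2)"

definition lambda2 :: "real \<Rightarrow> real" where
  "lambda2 u = 6 * (1 + u) / (1 + u + u\<^sup>2)"

definition lambda3 :: "real \<Rightarrow> real" where
  "lambda3 u = 6 * u * (1 + u) / (1 + u + u\<^sup>2)"

definition odd_one_out_unit :: "int \<Rightarrow> int \<Rightarrow> int \<Rightarrow> bool" where
  "odd_one_out_unit i j l \<longleftrightarrow>
     (i = 1 \<and> j \<le> 0 \<and> l \<le> 0) \<or> (i = - 1 \<and> j \<ge> 0 \<and> l \<ge> 0)"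

text \<open>
  Resonance Sign Condition. A vanishing component counts as having either sign, so that
  every Sternberg resonance \<open>\<lambda>\<^sub>i = m\<^sub>1 \<lambda>\<^sub>1 + m\<^sub>2 \<lambda>\<^sub>2 + m\<^sub>3 \<lambda>\<^sub>3\<close> with all \<open>m\<^sub>j \<ge> 0\<close>
  is covered. All triples satisfying the condition with three-valued signs
  are included.
\<close>
fun RSC :: "int \<times> int \<times> int \<Rightarrow> bool" where
  "RSC (k1, k2, k3) \<longleftrightarrow>
     (k1 \<ge> 0 \<and> k2 \<ge> 0 \<and> k3 \<ge> 0) \<or> (k1 \<le> 0 \<and> k2 \<le> 0 \<and> k3 \<le> 0) \<or>
     odd_one_out_unit k1 k2 k3 \<or> odd_one_out_unit k2 k1 k3 \<or> odd_one_out_unit k3 k1 k2"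

fun resonant :: "real \<Rightarrow> int \<times> int \<times> int \<Rightarrow> bool" where
  "resonant u (k1, k2, k3) \<longleftrightarrow>
     of_int k1 * lambda1 u + of_int k2 * lambda2 u + of_int k3 * lambda3 u = 0"

fun abs_order :: "int \<times> int \<times> int \<Rightarrow> int" where
  "abs_order (k1, k2, k3) = \<bar>k1\<bar> + \<bar>k2\<bar> + \<bar>k3\<bar>"

definition SNC :: "int \<Rightarrow> real \<Rightarrow> bool" where
  "SNC r u \<longleftrightarrow> \<not> (\<exists>k. k \<noteq> (0, 0, 0) \<and> resonant u k \<and> RSC k \<and> abs_order k \<le> r)"

text \<open>
  \<open>M\<close> and \<open>m'\<close> are the largest and smallest moduli of the stable eigenvalues, which coincide
  as only \<open>\<lambda>\<^sub>1\<close> is negative; \<open>N\<close> and \<open>n\<close> are those of the unstable eigenvalues.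
\<close>
definition beta1 :: "real \<Rightarrow> int" where
  "beta1 u = (let M = \<bar>lambda1 u\<bar>; n = \<bar>lambda2 u\<bar>; N = \<bar>lambda3 u\<bar>
              in \<lceil>(N + (M + n)) / n\<rceil>)"

definition alpha1 :: "real \<Rightarrow> int" where
  "alpha1 u = (let M = \<bar>lambda1 u\<bar>; m' = \<bar>lambda1 u\<bar>; N = \<bar>lambda3 u\<bar>
               in \<lceil>(M + of_int (beta1 u) * (N + m')) / m'\<rceil>)"

definition takens_linearizable :: "real \<Rightarrow> bool" where
  "takens_linearizable u \<longleftrightarrow> SNC (alpha1 u) u"

end

theory Submission
  imports Defs "HOL-Computational_Algebra.Polynomial"
begin

text \<open>
  A base point \<open>u = [m, a, b, a, b, ...]\<close> is a root of the quadratic with coefficients \<open>a\<close>,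
  \<open>a (b - 2 m)\<close>, \<open>-(a m (b - m) + b)\<close>, and \<open>u\<close> is irrational. A resonance \<open>k\<close> is the quadratic
  relation \<open>k\<^sub>3 u\<^sup>2 + (k\<^sub>2 + k\<^sub>3 - k\<^sub>1) u + k\<^sub>2 = 0\<close>, hence proportional to that one. Comparing
  coefficients, the component with the deviating sign is \<open>k\<^sub>3\<close> if \<open>m < b\<close> and \<open>k\<^sub>2\<close> if \<open>m = b\<close>;
  it can only be \<open>\<plusminus>1\<close> if \<open>a dvd b\<close> or \<open>b dvd a\<close>, respectively. So there is no resonance
  satisfying the sign condition, of any order.
\<close>

section \<open>Periodic continued fractions\<close>

text \<open>The positive root of \<open>b * x^2 - a * b * x - a = 0\<close>, which is
  \<open>x = a + 1 / (b + 1 / x)\<close> with denominators cleared.\<close>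

definition periodic_value :: "int \<Rightarrow> int \<Rightarrow> real" where
  "periodic_value a b = (of_int (a * b) + sqrt (of_int ((a * b)\<^sup>2 + 4 * (a * b)))) / (2 * of_int b)"

lemma periodic_value_unfold:
  assumes "a > 0" "b > 0"
  shows "periodic_value a b = of_int a + 1 / periodic_value b a"
proof -
  define p :: real where "p = of_int (a * b)"
  define s where "s = sqrt (of_int ((a * b)\<^sup>2 + 4 * (a * b)))"
  have p: "p > 0" using assms by (simp add: p_def)
  have ss: "s * s = p * p + 4 * p"
    using assms by (simp add: s_def p_def power2_eq_square)
  have s: "s > 0" using assms by (simp add: s_def add_pos_pos)
  have ab: "real_of_int a > 0" "real_of_int b > 0" using assms by auto
  have "periodic_value a b = (p + s) / (2 * of_int b)"
    and "periodic_value b a = (p + s) / (2 * of_int a)"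
    by (simp_all add: periodic_value_def p_def s_def mult.commute)
  moreover have "(p + s) / (2 * of_int b) = of_int a + 1 / ((p + s) / (2 * of_int a))"
  proof -
    have "1 / ((p + s) / (2 * of_int a)) = (s - p) / (2 * of_int b)"
    proof -
      \<comment> \<open>Rationalising: \<open>p\<close> and \<open>s\<close> are symmetric in
        \<open>a\<close> and \<open>b\<close>, so both values share the numerator
        \<open>p + s\<close>, and its conjugate yields the reciprocal.\<close>
      have "(s - p) * (p + s) = 4 * (real_of_int a * of_int b)"
        using ss by (simp add: p_def algebra_simps)
      then show ?thesis using ab p s by (simp add: field_simps)
    qed
    moreover have "of_int a = 2 * p / (2 * real_of_int b)"
      using ab by (simp add: p_def)
    ultimately show ?thesis by (simp add: add_divide_distrib diff_divide_distrib)
  qed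
  ultimately show ?thesis by simp
qed

lemma periodic_value_gt:
  assumes "a > 0" "b > 0"
  shows "periodic_value a b > of_int a"
proof -
  have "periodic_value b a > 0"
    using assms by (simp add: periodic_value_def add_pos_pos)
  then show ?thesis
    using periodic_value_unfold[OF assms] by simp
qed

lemma alternating_Suc: "(\<lambda>i. alternating a b (Suc i)) = alternating b a"
  by (auto simp: alternating_def)

lemma cfrac_convergent_alternating_ge:
  assumes "a > 0" "b > 0"
  shows "cfrac_convergent (alternating a b) n \<ge> of_int a"
  using assms
proof (induction n arbitrary: a b)
  case 0
  then show ?case by (simp add: alternating_def)
next
  case (Suc n)
  have "cfrac_convergent (alternating b a) n \<ge> of_int b"
    using Suc by blast
  moreover have "real_of_int b > 0" using Suc by simp
  ultimately have "cfrac_convergent (alternating b a) n > 0" by linarith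
  then show ?case by (simp add: alternating_Suc) (simp add: alternating_def)
qed

text \<open>One step \<open>c \<mapsto> a + 1 / c\<close> divides the distance between
  \<open>c\<close> and \<open>y\<close> by \<open>c * y\<close>, and both are at least 2 because the
  partial quotients are. Each step swaps \<open>a\<close> and \<open>b\<close>, hence the
  generalised induction.\<close>

lemma cfrac_convergent_alternating_error:
  assumes "a > 1" "b > 1"
  shows "\<bar>cfrac_convergent (alternating a b) n - periodic_value a b\<bar> \<le> (1 / 4) ^ n"
  using assms
proof (induction n arbitrary: a b)
  case 0
  have "periodic_value b a > 1"
    using periodic_value_gt[of b a] 0 by linarith
  then show ?case
    using periodic_value_unfold[of a b] 0 by (simp add: alternating_def)
next
  case (Suc n)
  define c where "c = cfrac_convergent (alternating b a) n"
  define y where "y = periodic_value b a"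
  have b: "real_of_int b \<ge> 2" using Suc.prems by simp
  have c: "c \<ge> 2"
    using cfrac_convergent_alternating_ge[of b a n] Suc.prems b by (simp add: c_def)
  have y: "y \<ge> 2"
    using periodic_value_gt[of b a] Suc.prems b by (simp add: y_def)
  have IH: "\<bar>c - y\<bar> \<le> (1 / 4) ^ n"
    using Suc by (simp add: c_def y_def)
  have "c * y \<ge> 2 * 2" using c y by (intro mult_mono) auto
  have "cfrac_convergent (alternating a b) (Suc n) - periodic_value a b = 1 / c - 1 / y"
    using periodic_value_unfold[of a b] Suc.prems
    by (simp add: alternating_Suc c_def y_def) (simp add: alternating_def)
  also have "\<bar>\<dots>\<bar> = \<bar>c - y\<bar> / (c * y)"
    using c y by (simp add: diff_frac_eq abs_mult abs_minus_commute)
  also have "\<dots> \<le> (1 / 4) ^ n / 4"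
    using IH \<open>c * y \<ge> 2 * 2\<close> by (intro frac_le) auto
  finally show ?case by simp
qed

lemma cfrac_convergent_alternating_tendsto:
  assumes "a > 1" "b > 1"
  shows "cfrac_convergent (alternating a b) \<longlonglongrightarrow> periodic_value a b"
proof -
  have "(\<lambda>n. (1 / 4 :: real) ^ n) \<longlonglongrightarrow> 0"
    by (rule LIMSEQ_power_zero) simp
  then have "(\<lambda>n. cfrac_convergent (alternating a b) n - periodic_value a b) \<longlonglongrightarrow> 0"
    by (rule tendsto_0_le[where K = 1])
       (simp add: cfrac_convergent_alternating_error assms)
  then show ?thesis
    by (simp add: LIM_zero_iff)
qed

lemma cfrac_alternating:
  assumes "a > 1" "b > 1"
  shows "cfrac (alternating a b) = periodic_value a b"
  unfolding cfrac_def by (rule limI) (rule cfrac_convergent_alternating_tendsto[OF assms])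

lemma cfrac_case_nat:
  assumes "cfrac_convergent c \<longlonglongrightarrow> L" "L \<noteq> 0"
  shows "cfrac (case_nat m c) = of_int m + 1 / L"
  unfolding cfrac_def
proof (rule limI)
  have "(\<lambda>n. of_int m + 1 / cfrac_convergent c n) \<longlonglongrightarrow> of_int m + 1 / L"
    using assms by (intro tendsto_intros)
  then have "(\<lambda>n. cfrac_convergent (case_nat m c) (Suc n)) \<longlonglongrightarrow> of_int m + 1 / L"
    by simp
  then show "cfrac_convergent (case_nat m c) \<longlonglongrightarrow> of_int m + 1 / L"
    by (rule LIMSEQ_imp_Suc)
qed

lemma cfrac_case_nat_alternating:
  assumes "a > 1" "b > 1"
  shows "cfrac (case_nat m (alternating a b)) = of_int m + 1 / periodic_value a b"
proof (rule cfrac_case_nat[OF cfrac_convergent_alternating_tendsto[OF assms]])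
  show "periodic_value a b \<noteq> 0"
    using periodic_value_gt[of a b] assms by auto
qed

section \<open>The orbit of the Kasner map\<close>

text \<open>The Kasner map is a slow Gauss map: the integer part counts down to 1 before the
  fractional part is inverted.\<close>

lemma kasner_map_of_int_add:
  assumes "0 < t" "t < 1" "m \<ge> 1"
  shows "kasner_map (of_int m + t) = (if m = 1 then 1 / t else of_int (m - 1) + t)"
proof (cases "m = 1")
  case False
  then have "real_of_int m \<ge> 2" using assms by simp
  then show ?thesis using assms False by (simp add: kasner_map_def)
qed (use assms in \<open>simp add: kasner_map_def\<close>)

lemma kasner_map_funpow_of_int_add:
  assumes "0 < t" "t < 1" "int j < m"
  shows "(kasner_map ^^ j) (of_int m + t) = of_int (m - int j) + t"
  using assms(3)
proof (induction j)
  case (Suc j)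
  then have "(kasner_map ^^ Suc j) (of_int m + t) = kasner_map (of_int (m - int j) + t)"
    by simp
  also have "\<dots> = of_int (m - int j - 1) + t"
    using kasner_map_of_int_add[OF assms(1,2), of "m - int j"] Suc.prems by simp
  finally show ?case by (simp add: algebra_simps)
qed simp

lemma kasner_map_funpow_inverse:
  assumes "0 < t" "t < 1" "m \<ge> 1"
  shows "(kasner_map ^^ nat m) (of_int m + t) = 1 / t"
proof -
  have "nat m = Suc (nat (m - 1))" using assms(3) by simp
  moreover have "(kasner_map ^^ nat (m - 1)) (of_int m + t) = of_int 1 + t"
    using kasner_map_funpow_of_int_add[OF assms(1,2), of "nat (m - 1)" m] assms(3) by simp
  ultimately show ?thesis
    using kasner_map_of_int_add[OF assms(1,2), of 1] by simp
qed

text \<open>The orbit is a cycle: \<open>a + s\<close> counts down to \<open>1 + s\<close>, jumps to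
  \<open>b + t\<close>, counts down to \<open>1 + t\<close> and jumps back. One inclusion is forward
  invariance of the right-hand side, the other names an iterate for each element.\<close>

lemma base_points_periodic:
  fixes s t :: real
  assumes "0 < s" "s < 1" "0 < t" "t < 1" "a \<ge> 1" "b \<ge> 1"
    and s: "1 / s = of_int b + t" and t: "1 / t = of_int a + s"
  shows "base_points (of_int a + s) =
           {of_int m + t | m. 1 \<le> m \<and> m \<le> b} \<union> {of_int m + s | m. 1 \<le> m \<and> m \<le> a}"
    (is "_ = ?T \<union> ?S")
proof (intro equalityI subsetI)
  fix v assume "v \<in> base_points (of_int a + s)"
  then obtain j where v: "v = (kasner_map ^^ j) (of_int a + s)"
    by (auto simp: base_points_def)
  have step: "kasner_map w \<in> ?T \<union> ?S" if w: "w \<in> ?T \<union> ?S" for w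
    using w
  proof
    assume "w \<in> ?T"
    then obtain m where m: "w = of_int m + t" "1 \<le> m" "m \<le> b" by auto
    show ?thesis
    proof (cases "m = 1")
      case True
      then have "kasner_map w = of_int a + s"
        using kasner_map_of_int_add[of t m] m assms by simp
      then show ?thesis using assms by auto
    next
      case False
      then have "kasner_map w = of_int (m - 1) + t"
        using kasner_map_of_int_add[of t m] m assms by simp
      moreover have "1 \<le> m - 1" "m - 1 \<le> b" using m False by auto
      ultimately show ?thesis by blast
    qed
  next
    assume "w \<in> ?S"
    then obtain m where m: "w = of_int m + s" "1 \<le> m" "m \<le> a" by auto
    show ?thesis
    proof (cases "m = 1")
      case True
      then have "kasner_map w = of_int b + t"
        using kasner_map_of_int_add[of s m] m assms by simp
      then show ?thesis using assms by auto
    next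
      case False
      then have "kasner_map w = of_int (m - 1) + s"
        using kasner_map_of_int_add[of s m] m assms by simp
      moreover have "1 \<le> m - 1" "m - 1 \<le> a" using m False by auto
      ultimately show ?thesis by blast
    qed
  qed
  have "(kasner_map ^^ j) (of_int a + s) \<in> ?T \<union> ?S"
  proof (induction j)
    case 0
    then show ?case using assms by auto
  next
    case (Suc j)
    then show ?case using step by simp
  qed
  then show "v \<in> ?T \<union> ?S" using v by simp
next
  fix v assume "v \<in> ?T \<union> ?S"
  then show "v \<in> base_points (of_int a + s)"
  proof
    assume "v \<in> ?T"
    then obtain m where m: "v = of_int m + t" "1 \<le> m" "m \<le> b" by auto
    \<comment> \<open>The first \<open>a\<close> steps exhaust the block of \<open>s\<close> and
      arrive at \<open>b + t\<close>; \<open>b - m\<close> decrements remain.\<close>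
    have "(kasner_map ^^ (nat (b - m) + nat a)) (of_int a + s) =
            (kasner_map ^^ nat (b - m)) (of_int b + t)"
      using kasner_map_funpow_inverse[of s a] assms by (simp add: funpow_add)
    also have "\<dots> = v"
      using kasner_map_funpow_of_int_add[of t "nat (b - m)" b] m assms by simp
    finally show ?thesis by (force simp: base_points_def)
  next
    assume "v \<in> ?S"
    then obtain m where m: "v = of_int m + s" "1 \<le> m" "m \<le> a" by auto
    then have "(kasner_map ^^ nat (a - m)) (of_int a + s) = v"
      using kasner_map_funpow_of_int_add[of s "nat (a - m)" a] assms by simp
    then show ?thesis by (force simp: base_points_def)
  qed
qed

section \<open>Absence of resonances\<close>

text \<open>The right side lies strictly between \<open>p^2\<close> and \<open>(p + 2)^2\<close>,
  and parity rules out \<open>(p + 1)^2\<close>.\<close>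

lemma square_neq_square_add_4_times:
  fixes p z :: int
  assumes "p > 0"
  shows "z\<^sup>2 \<noteq> p\<^sup>2 + 4 * p"
proof
  assume z: "z\<^sup>2 = p\<^sup>2 + 4 * p"
  have "p\<^sup>2 < \<bar>z\<bar>\<^sup>2" "\<bar>z\<bar>\<^sup>2 < (p + 2)\<^sup>2"
    using z assms by (simp_all add: power2_eq_square algebra_simps)
  then have "p < \<bar>z\<bar>" "\<bar>z\<bar> < p + 2"
    using assms by (auto intro: power_less_imp_less_base[of _ 2])
  then have "\<bar>z\<bar> = p + 1" by simp
  then have "z\<^sup>2 = (p + 1)\<^sup>2" by (metis power2_abs)
  then have "2 * p = 1" using z by (simp add: power2_eq_square algebra_simps)
  then show False by presburger
qed

lemma irrational_periodic:
  fixes t :: real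
  assumes "a > 0" "b > 0" and t: "of_int a * t\<^sup>2 + of_int (a * b) * t = of_int b"
  shows "t \<notin> \<rat>"
proof
  assume "t \<in> \<rat>"
  \<comment> \<open>Completing the square: \<open>w\<close> is the derivative of the quadratic at
    \<open>t\<close>, so its square is the discriminant.\<close>
  define w where "w = 2 * of_int a * t + of_int (a * b)"
  have "w \<in> \<rat>" using \<open>t \<in> \<rat>\<close> by (simp add: w_def)
  have "w\<^sup>2 = 4 * of_int a * (of_int a * t\<^sup>2 + of_int (a * b) * t) + (of_int (a * b))\<^sup>2"
    by (simp add: w_def power2_eq_square algebra_simps)
  then have w2: "w\<^sup>2 = of_int ((a * b)\<^sup>2 + 4 * (a * b))"
    unfolding t by (simp add: power2_eq_square algebra_simps)
  \<comment> \<open>A square root of an integer is an algebraic integer, so being rational it is an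
    integer.\<close>
  have "algebraic_int (w\<^sup>2)" unfolding w2 by (rule int_imp_algebraic_int) simp
  then have "algebraic_int (sqrt (w\<^sup>2))" by (rule algebraic_int_sqrt)
  then have "algebraic_int \<bar>w\<bar>" by simp
  moreover have "\<bar>w\<bar> \<in> \<rat>" using \<open>w \<in> \<rat>\<close> by simp
  ultimately have "\<bar>w\<bar> \<in> \<int>" by (rule rational_algebraic_int_is_int)
  then obtain z where "\<bar>w\<bar> = of_int z" by (auto elim: Ints_cases)
  then have "w\<^sup>2 = of_int (z\<^sup>2)" by (metis of_int_power power2_abs)
  then have "z\<^sup>2 = (a * b)\<^sup>2 + 4 * (a * b)" using w2 by linarith
  then show False
    using square_neq_square_add_4_times[of "a * b" z] assms by simp
qed

lemma irrational_linear_eq_0: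
  fixes u :: real and p q :: int
  assumes "u \<notin> \<rat>" "of_int p * u + of_int q = 0"
  shows "p = 0 \<and> q = 0"
proof -
  have "p = 0"
  proof (rule ccontr)
    assume "p \<noteq> 0"
    then have "u = - of_int q / of_int p" using assms(2) by (simp add: field_simps)
    then show False using assms(1) by simp
  qed
  then show ?thesis using assms(2) by simp
qed

text \<open>The eigenvalues share a positive denominator and the factor 6; clearing both leaves a
  polynomial in \<open>u\<close>.\<close>

lemma resonant_iff_quadratic:
  assumes "u > 0"
  shows "resonant u (k1, k2, k3) \<longleftrightarrow>
           of_int k3 * u\<^sup>2 + of_int (k2 + k3 - k1) * u + of_int k2 = 0"
proof -
  have d: "1 + u + u\<^sup>2 > 0" using assms by (simp add: add_pos_pos)
  define Q where "Q = of_int k3 * u\<^sup>2 + of_int (k2 + k3 - k1) * u + of_int k2"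
  have "of_int k1 * lambda1 u + of_int k2 * lambda2 u + of_int k3 * lambda3 u =
          6 * Q / (1 + u + u\<^sup>2)"
    unfolding Q_def using d by (simp add: lambda1_def lambda2_def lambda3_def divide_simps)
      (simp add: power2_eq_square algebra_simps)
  then have "resonant u (k1, k2, k3) \<longleftrightarrow> Q = 0" using d by simp
  then show ?thesis unfolding Q_def .
qed

text \<open>Eliminating \<open>u^2\<close> between the resonance and the quadratic of
  \<open>u\<close> leaves an integer linear relation, whose coefficients vanish since
  \<open>u\<close> is irrational.\<close>

lemma resonant_proportional:
  fixes t :: real
  assumes "a > 0" "b > 0" "t > 0" "m \<ge> 1"
    and t: "of_int a * t\<^sup>2 + of_int (a * b) * t = of_int b"
    and res: "resonant (of_int m + t) (k1, k2, k3)"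
  shows "a * k2 = - k3 * (a * (m * (b - m)) + b)"
    and "a * k1 = - k3 * (a * ((m + 1) * (b - m - 1)) + b)"
proof -
  define u where "u = of_int m + t"
  have "u > 0" using assms by (simp add: u_def add_pos_pos)
  have u: "u \<notin> \<rat>"
  proof
    assume "u \<in> \<rat>"
    then have "u - of_int m \<in> \<rat>" by (intro Rats_diff) auto
    then show False using irrational_periodic[OF assms(1,2) t] by (simp add: u_def)
  qed
  define B where "B = k2 + k3 - k1"
  have k: "of_int k3 * u\<^sup>2 + of_int B * u + of_int k2 = 0"
    using res resonant_iff_quadratic[OF \<open>u > 0\<close>] by (simp add: u_def B_def)
  \<comment> \<open>\<open>B'\<close> and \<open>- C'\<close> come from substituting
    \<open>t = u - m\<close> into the quadratic of \<open>t\<close>.\<close>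
  define B' where "B' = a * (b - 2 * m)"
  define C' where "C' = a * (m * (b - m)) + b"
  have "of_int a * u\<^sup>2 + of_int B' * u - of_int C' = of_int a * t\<^sup>2 + of_int (a * b) * t - of_int b"
    by (simp add: B'_def C'_def u_def power2_eq_square algebra_simps)
  then have q: "of_int a * u\<^sup>2 + of_int B' * u - of_int C' = 0"
    using t by simp
  have "of_int (a * B - k3 * B') * u + of_int (a * k2 + k3 * C') =
      of_int a * (of_int k3 * u\<^sup>2 + of_int B * u + of_int k2)
      - of_int k3 * (of_int a * u\<^sup>2 + of_int B' * u - of_int C')"
    by (simp add: algebra_simps)
  then have "of_int (a * B - k3 * B') * u + of_int (a * k2 + k3 * C') = 0"
    by (simp only: k q)
  then have 1: "a * B - k3 * B' = 0" and 2: "a * k2 + k3 * C' = 0"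
    using irrational_linear_eq_0[OF u] by blast+
  show "a * k2 = - k3 * (a * (m * (b - m)) + b)"
    using 2 by (simp add: C'_def)
  \<comment> \<open>Solving the middle coefficient for \<open>k1\<close> turns \<open>C'\<close>
    into \<open>C' - a + B'\<close>, which is \<open>C'\<close> with \<open>m + 1\<close> in place
    of \<open>m\<close>.\<close>
  have "a * k1 = a * k2 + a * k3 - k3 * B'"
    using 1 by (simp add: B_def algebra_simps)
  then show "a * k1 = - k3 * (a * ((m + 1) * (b - m - 1)) + b)"
    using 2 by (simp add: B'_def C'_def algebra_simps)
qed

lemma sgn_eq_of_mult_eq:
  fixes a c k l :: "'a :: linordered_idom"
  assumes "a * k = l * c" "a > 0" "c > 0"
  shows "sgn k = sgn l"
proof -
  have "sgn a * sgn k = sgn l * sgn c" using assms(1) by (metis sgn_mult)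
  then show ?thesis using assms(2,3) by simp
qed

lemma no_resonance:
  fixes t :: real
  assumes adm: "admissible a b" and "t > 0" and m: "1 \<le> m" "m \<le> b"
    and t: "of_int a * t\<^sup>2 + of_int (a * b) * t = of_int b"
    and res: "resonant (of_int m + t) (k1, k2, k3)" and rsc: "RSC (k1, k2, k3)"
  shows "k1 = 0 \<and> k2 = 0 \<and> k3 = 0"
proof -
  have ab: "a > 1" "b > 1" and ndvd: "\<not> a dvd b" "\<not> b dvd a"
    using adm by (auto simp: admissible_def)
  have k2: "a * k2 = - k3 * (a * (m * (b - m)) + b)"
    and k1: "a * k1 = - k3 * (a * ((m + 1) * (b - m - 1)) + b)"
    using resonant_proportional[OF _ _ _ _ t res] ab assms by auto
  have s2: "sgn k2 = - sgn k3"
    using sgn_eq_of_mult_eq[OF k2] ab m by (simp add: add_nonneg_pos sgn_minus)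
  show ?thesis
  proof (cases "m = b")
    case False
    \<comment> \<open>For \<open>m < b\<close> the products in \<open>k1\<close> and
      \<open>k2\<close> are nonnegative, so both components oppose \<open>k3\<close>. The sign
      condition then leaves only zero or a unit \<open>k3\<close>.\<close>
    have "sgn k1 = - sgn k3"
      using sgn_eq_of_mult_eq[OF k1] ab m False by (simp add: add_nonneg_pos sgn_minus)
    with s2 rsc have "k3 = 0 \<and> k1 = 0 \<and> k2 = 0 \<or> k3 = 1 \<or> k3 = - 1"
      by (auto simp: odd_one_out_unit_def sgn_if split: if_splits)
    moreover have False if "\<bar>k3\<bar> = 1"
    proof -
      \<comment> \<open>Reading the formula for \<open>k2\<close> modulo \<open>a\<close>: a unit
        \<open>k3\<close> would give \<open>a dvd b\<close>.\<close>
      have "k3 * b = a * (- k2 - k3 * (m * (b - m)))"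
        using k2 by (simp add: algebra_simps)
      then have "a dvd k3 * b" by simp
      then show False using that ndvd by (auto simp: abs_if split: if_splits)
    qed
    ultimately show ?thesis by auto
  next
    case True
    \<comment> \<open>At \<open>m = b\<close> the bracket for \<open>k1\<close> is
      \<open>b - a * (b + 1)\<close>, now negative, so \<open>k1\<close> sides with
      \<open>k3\<close> and \<open>k2\<close> becomes the deviating component.\<close>
    have "b < a * (b + 1)"
      using mult_right_mono[of 1 a "b + 1"] ab by (smt (verit))
    moreover have "a * k1 = k3 * (a * (b + 1) - b)"
      using k1 True by (simp add: algebra_simps)
    ultimately have "sgn k1 = sgn k3"
      using sgn_eq_of_mult_eq[of a k1 k3 "a * (b + 1) - b"] ab by simp
    with s2 rsc have "k3 = 0 \<and> k1 = 0 \<and> k2 = 0 \<or> k2 = 1 \<or> k2 = - 1"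
      by (auto simp: odd_one_out_unit_def sgn_if split: if_splits)
    moreover have False if "\<bar>k2\<bar> = 1"
    proof -
      have "a * k2 = b * (- k3)" using k2 True by simp
      then have "b dvd a * k2" by simp
      then show False using that ndvd by (auto simp: abs_if split: if_splits)
    qed
    ultimately show ?thesis by auto
  qed
qed

lemma takens_linearizable_periodic:
  assumes "admissible a b" "1 \<le> m" "m \<le> b"
  shows "takens_linearizable (of_int m + 1 / periodic_value a b)"
proof -
  define x where "x = periodic_value a b"
  define y where "y = periodic_value b a"
  have ab: "a > 1" "b > 1" using assms by (auto simp: admissible_def)
  have pos: "x > 0" "y > 0"
    using periodic_value_gt[of a b] periodic_value_gt[of b a] ab
    by (auto simp: x_def y_def intro: less_trans[of 0 "of_int _"])
  have xy: "x = of_int a + 1 / y" "y = of_int b + 1 / x"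
    using ab by (auto simp: x_def y_def intro!: periodic_value_unfold)
  \<comment> \<open>Two expressions for \<open>x * y\<close> give \<open>a * y = b * x\<close>,
    which eliminates \<open>y\<close> and leaves a quadratic for \<open>1 / x\<close>.\<close>
  have xy1: "x * y = of_int a * y + 1"
    by (subst xy(1)) (use pos in \<open>simp add: field_simps\<close>)
  have xy2: "x * y = of_int b * x + 1"
    by (subst xy(2)) (use pos in \<open>simp add: field_simps\<close>)
  have "of_int a * (of_int b * x + 1) = x * (of_int a * y)"
    unfolding xy2[symmetric] by simp
  also have "of_int a * y = of_int b * x" using xy1 xy2 by linarith
  finally have "of_int a * (of_int b * x + 1) = of_int b * x * x" by simp
  then have "of_int a * (1 / x)\<^sup>2 + of_int (a * b) * (1 / x) = of_int b"
    using pos by (simp add: field_simps power2_eq_square)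
  then show ?thesis
    using no_resonance[of a b "1 / x" m] assms pos
    by (auto simp: takens_linearizable_def SNC_def x_def)
qed

theorem theorem0p3:
  fixes a b :: int
  assumes "admissible a b"
  shows "base_points (cfrac (alternating a b)) =
           {cfrac (case_nat m (alternating a b)) | m. 1 \<le> m \<and> m \<le> b} \<union>
           {cfrac (case_nat m (alternating b a)) | m. 1 \<le> m \<and> m \<le> a} \<and>
         (\<forall>v \<in> base_points (cfrac (alternating a b)). takens_linearizable v)"
proof -
  have ab: "a > 1" "b > 1" and adm: "admissible b a"
    using assms by (auto simp: admissible_def)
  define x where "x = periodic_value a b"
  define y where "y = periodic_value b a"
  have gt: "x > 1" "y > 1"
    using periodic_value_gt[of a b] periodic_value_gt[of b a] ab
    by (auto simp: x_def y_def intro: less_trans[of 1 "of_int _"])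
  have xy: "x = of_int a + 1 / y" "y = of_int b + 1 / x"
    using ab by (auto simp: x_def y_def intro!: periodic_value_unfold)
  have cf: "cfrac (alternating a b) = of_int a + 1 / y"
    using cfrac_alternating[OF ab] xy(1) by (simp add: x_def)
  have "1 / (1 / y) = of_int b + 1 / x" "1 / (1 / x) = of_int a + 1 / y"
    using xy by (metis div_by_1 divide_divide_eq_right mult_1)+
  then have "base_points (of_int a + 1 / y) =
      {of_int m + 1 / x | m. 1 \<le> m \<and> m \<le> b} \<union> {of_int m + 1 / y | m. 1 \<le> m \<and> m \<le> a}"
    using gt ab by (intro base_points_periodic) simp_all
  \<comment> \<open>The second family of base points is the first with \<open>a\<close> and
    \<open>b\<close> exchanged, and admissibility is symmetric.\<close>
  then show ?thesis
    using takens_linearizable_periodic[OF assms] takens_linearizable_periodic[OF adm]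
    by (auto simp: cf cfrac_case_nat_alternating ab x_def y_def)
qed

end
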